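(* Let $K$ be a positive integer and $A \geq 1$. For every $z\in\mathbb C$ there exist complex numbers $(c_{\ell})_{0\leq \ell < K}$ such that for all real $x \geq 1$, all multiplicative functions $f:\mathbb N\to\mathbb C$ and all positive integers $n \leq x$, \[ f^{ (\ast z) }(n) = \sum_{0\leq \ell < K} c_\ell \sum_{\substack{n = n_1 n_2 \\ P^+(n_1) \leq x^{1/K}}} f^{ (\ast (z-\ell)) }(n_1)\, f^{ (\ast \ell) }(n_2). \] Moreover, $|c_\ell| \le C$ for all $|z|\le A$ and $0\le\ell<K$, with $C$ depending only on $K$ and $A$.
   Context: $P^+(n)$ denotes the largest prime factor of $n>1$, with $P^+(1)=1$. For a multiplicative function $f$ and $z\in\mathbb C$, the $z$-fold convolution $f^{(\ast z)}$ is the multiplicative function with $f^{(\ast z)}(1)=1$ and, for primes $p$ and $\nu\ge1$, \[ f^{ (\ast z) }(p^\nu) := \sum_{1\leq r\leq \nu} \binom zr \sum_{\substack{\lambda_1, \dotsc, \lambda_r \geq 1 \\ \lambda_1 + \dotsb + \lambda_r = \nu}} f(p^{\lambda_1}) \cdots f(p^{\lambda_r}), \] where $\binom zr = z(z-1)\cdots(z-r+1)/r!$. For $z=\ell\in\mathbb N$ this is the usual $\ell$-fold Dirichlet convolution (with $f^{(\ast 0)}$ the unit $n\mapsto \mathbf 1_{n=1}$). *)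

theory Defs
  imports Complex_Main "HOL-Computational_Algebra.Computational_Algebra"
begin

definition multiplicative_fun :: "(nat \<Rightarrow> complex) \<Rightarrow> bool" where
  "multiplicative_fun f \<longleftrightarrow>
     f 1 = 1 \<and> (\<forall>m n. m > 0 \<longrightarrow> n > 0 \<longrightarrow> coprime m n \<longrightarrow> f (m * n) = f m * f n)"

definition largest_prime_factor :: "nat \<Rightarrow> nat" where
  "largest_prime_factor n = (if n > 1 then Max (prime_factors n) else 1)"

definition compositions :: "nat \<Rightarrow> nat \<Rightarrow> nat list set" where
  "compositions r \<nu> = {ls. length ls = r \<and> (\<forall>l\<in>set ls. l \<ge> 1) \<and> sum_list ls = \<nu>}"

definition zfold_local :: "(nat \<Rightarrow> complex) \<Rightarrow> complex \<Rightarrow> nat \<Rightarrow> nat \<Rightarrow> complex" where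
  "zfold_local f z p \<nu> =
     (\<Sum>r=1..\<nu>. (z gchoose r) * (\<Sum>ls\<in>compositions r \<nu>. \<Prod>l\<leftarrow>ls. f (p ^ l)))"

text \<open>The multiplicative function whose value at each prime power \<open>p ^ \<nu>\<close> with \<open>\<nu> \<ge> 1\<close> is
  \<^term>\<open>zfold_local f z p \<nu>\<close>; only the values at positive integers are meaningful.\<close>

definition zfold_conv :: "(nat \<Rightarrow> complex) \<Rightarrow> complex \<Rightarrow> nat \<Rightarrow> complex" where
  "zfold_conv f z n = (\<Prod>p\<in>prime_factors n. zfold_local f z p (multiplicity p n))"

lemma finite_compositions: "finite (compositions r \<nu>)"
proof (rule finite_subset)
  show "compositions r \<nu> \<subseteq> {ls. set ls \<subseteq> {..\<nu>} \<and> length ls = r}"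
    unfolding compositions_def using member_le_sum_list by fastforce
  show "finite {ls. set ls \<subseteq> {..\<nu>} \<and> length ls = r}"
    by (rule finite_lists_length_eq) simp
qed

lemma zfold_conv_1: "zfold_conv f z 1 = 1"
  by (simp add: zfold_conv_def)

lemma zfold_conv_prime_power:
  assumes "prime p" "\<nu> \<ge> 1"
  shows "zfold_conv f z (p ^ \<nu>) = zfold_local f z p \<nu>"
  using assms by (simp add: zfold_conv_def prime_factorization_prime_power)

lemma multiplicative_zfold_conv: "multiplicative_fun (zfold_conv f z)"
  unfolding multiplicative_fun_def
proof (intro conjI allI impI)
  show "zfold_conv f z 1 = 1" by (rule zfold_conv_1)
next
  fix m n :: nat
  assume pos: "m > 0" "n > 0" and cop: "coprime m n"
  have disj: "prime_factors m \<inter> prime_factors n = {}"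
    using cop coprime_common_divisor not_prime_unit by (blast dest: in_prime_factors_imp_dvd in_prime_factors_imp_prime)
  have mult: "multiplicity p (m * n) = multiplicity p m + multiplicity p n"
    if "prime p" for p
    using that pos by (simp add: prime_elem_multiplicity_mult_distrib)
  have zero: "multiplicity p b = 0"
    if "p \<in> prime_factors a" "prime_factors a \<inter> prime_factors b = {}" "b > 0" for p a b :: nat
    using that by (auto simp: prime_factors_dvd intro!: not_dvd_imp_multiplicity_0)
  have "zfold_conv f z (m * n) =
      (\<Prod>p\<in>prime_factors m \<union> prime_factors n. zfold_local f z p (multiplicity p (m * n)))"
    using pos by (simp add: zfold_conv_def prime_factors_product)
  also have "\<dots> = (\<Prod>p\<in>prime_factors m. zfold_local f z p (multiplicity p (m * n))) *
      (\<Prod>p\<in>prime_factors n. zfold_local f z p (multiplicity p (m * n)))"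
    using disj by (intro prod.union_disjoint) auto
  also have "(\<Prod>p\<in>prime_factors m. zfold_local f z p (multiplicity p (m * n))) = zfold_conv f z m"
    unfolding zfold_conv_def using disj pos
    by (intro prod.cong refl) (simp add: mult zero in_prime_factors_imp_prime)
  also have "(\<Prod>p\<in>prime_factors n. zfold_local f z p (multiplicity p (m * n))) = zfold_conv f z n"
    unfolding zfold_conv_def using disj pos
    by (intro prod.cong refl) (simp add: mult zero[of _ n m] Int_commute in_prime_factors_imp_prime)
  finally show "zfold_conv f z (m * n) = zfold_conv f z m * zfold_conv f z n" .
qed

end

theory Submission
  imports Defs
begin

text \<open>
  The values of the \<open>z\<close>-fold convolution at the powers of \<open>p\<close> are the coefficients of
  \<open>(1 + F) ^ z\<close>, where \<open>F = f(p) X + f(p\<^sup>2) X\<^sup>2 + \<dots>\<close>. Hence the \<open>u\<close>-fold and \<open>v\<close>-fold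
  convolutions of \<open>f\<close> convolve to the \<open>(u + v)\<close>-fold one. Write \<open>y = x powr (1/K)\<close> and
  \<open>n = a b\<close> with \<open>a\<close> composed of primes at most \<open>y\<close> and \<open>b\<close> of primes exceeding \<open>y\<close>. Then the
  inner sum for \<open>l\<close> is the \<open>z\<close>-fold convolution at \<open>a\<close> times the \<open>l\<close>-fold convolution at \<open>b\<close>.
  Since \<open>b \<le> y ^ K\<close>, the number \<open>b\<close> has fewer than \<open>K\<close> prime factors with multiplicity, so the
  \<open>w\<close>-fold convolution at \<open>b\<close> is a polynomial in \<open>w\<close> of degree less than \<open>K\<close>. Lagrange
  interpolation at the nodes \<open>0, \<dots>, K - 1\<close> recovers its value at \<open>z\<close>, and the coefficients
  \<open>c\<^sub>l\<close> are the Lagrange basis polynomials evaluated at \<open>z\<close>.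
\<close>

section \<open>Lagrange interpolation\<close>

definition lagrange_basis :: "'a::field set \<Rightarrow> 'a \<Rightarrow> 'a poly" where
  "lagrange_basis S a = (\<Prod>b\<in>S - {a}. smult (1 / (a - b)) [:- b, 1:])"

lemma poly_lagrange_basis:
  "poly (lagrange_basis S a) x = (\<Prod>b\<in>S - {a}. (x - b) / (a - b))"
  by (simp add: lagrange_basis_def poly_prod diff_divide_distrib)

lemma poly_lagrange_basis_node:
  assumes "finite S" "x \<in> S"
  shows "poly (lagrange_basis S a) x = (if a = x then 1 else 0)"
proof (cases "a = x")
  case True
  then show ?thesis by (auto simp: poly_lagrange_basis intro!: prod.neutral split: if_splits)
next
  case False
  then show ?thesis using assms by (auto simp: poly_lagrange_basis intro!: prod_zero)
qed

lemma degree_lagrange_basis_less: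
  assumes "finite S" "a \<in> S"
  shows "degree (lagrange_basis S a) < card S"
proof -
  have "degree (lagrange_basis S a) \<le> (\<Sum>b\<in>S - {a}. 1)"
    unfolding lagrange_basis_def using assms(1)
    by (intro order.trans[OF degree_prod_sum_le] sum_mono) auto
  also have "\<dots> = card (S - {a})" by simp
  also have "\<dots> < card S" using assms by (rule card_Diff1_less)
  finally show ?thesis .
qed

lemma lagrange_interpolation:
  fixes P :: "'a::field poly"
  assumes "finite S" "degree P < card S"
  shows "P = (\<Sum>a\<in>S. smult (poly P a) (lagrange_basis S a))" (is "P = ?Q")
proof (rule poly_eqI_degree[where A = S])
  show "poly P x = poly ?Q x" if "x \<in> S" for x
    using assms(1) that by (simp add: poly_sum poly_lagrange_basis_node if_distrib cong: if_cong)
  show "degree ?Q < card S"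
    using assms degree_lagrange_basis_less[of S]
    by (intro degree_sum_less) (auto intro: le_less_trans[OF degree_smult_le])
qed (fact assms(2))

lemma norm_poly_lagrange_basis_le:
  fixes x :: "'a::real_normed_field"
  assumes "finite S" "a \<in> S"
    and separated: "\<And>b. b \<in> S - {a} \<Longrightarrow> dist a b \<ge> 1"
    and near: "\<And>b. b \<in> S \<Longrightarrow> dist x b \<le> R"
  shows "norm (poly (lagrange_basis S a) x) \<le> R ^ (card S - 1)"
proof -
  have "norm (poly (lagrange_basis S a) x) = (\<Prod>b\<in>S - {a}. dist x b / dist a b)"
    by (simp add: poly_lagrange_basis dist_norm norm_divide flip: prod_norm)
  also have "\<dots> \<le> (\<Prod>b\<in>S - {a}. R)"
  proof (intro prod_mono conjI)
    fix b assume b: "b \<in> S - {a}"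
    have "dist x b / dist a b \<le> dist x b / 1"
      using separated[OF b] by (intro divide_left_mono) auto
    also have "\<dots> \<le> R" using near b by simp
    finally show "dist x b / dist a b \<le> R" .
  qed simp
  also have "\<dots> = R ^ (card S - 1)" using assms(1,2) by simp
  finally show ?thesis .
qed

definition lagrange_coeff :: "nat \<Rightarrow> 'a::field_char_0 \<Rightarrow> nat \<Rightarrow> 'a" where
  "lagrange_coeff K z l = poly (lagrange_basis (of_nat ` {..<K}) (of_nat l)) z"

lemma card_of_nat_image_lessThan: "card (of_nat ` {..<K} :: 'a::semiring_char_0 set) = K"
  by (simp add: card_image inj_on_def)

lemma lagrange_interpolation_of_nat:
  assumes "degree P < K"
  shows "poly P z = (\<Sum>l<K. lagrange_coeff K z l * poly P (of_nat l))"
proof -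
  have "P = (\<Sum>a\<in>of_nat ` {..<K}. smult (poly P a) (lagrange_basis (of_nat ` {..<K}) a))"
    using assms by (intro lagrange_interpolation) (simp_all add: card_of_nat_image_lessThan)
  also have "\<dots> = (\<Sum>l<K. smult (poly P (of_nat l)) (lagrange_basis (of_nat ` {..<K}) (of_nat l)))"
    by (simp add: sum.reindex inj_on_def)
  finally have "poly P z = poly \<dots> z" by simp
  then show ?thesis by (simp add: poly_sum lagrange_coeff_def mult.commute)
qed

lemma norm_lagrange_coeff_le:
  fixes z :: "'a::real_normed_field"
  assumes "norm z \<le> A" "l < K"
  shows "norm (lagrange_coeff K z l) \<le> (A + real K) ^ (K - 1)"
proof -
  let ?S = "of_nat ` {..<K} :: 'a set"
  have "dist z b \<le> A + real K" if "b \<in> ?S" for b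
    using that assms(1) norm_triangle_ineq4[of z b] by (auto simp: dist_norm)
  moreover have "dist (of_nat l) b \<ge> 1" if "b \<in> ?S - {of_nat l}" for b :: 'a
    using that by (auto simp: dist_of_nat)
  ultimately have "norm (lagrange_coeff K z l) \<le> (A + real K) ^ (card ?S - 1)"
    unfolding lagrange_coeff_def using assms(2) by (intro norm_poly_lagrange_basis_le) auto
  then show ?thesis by (simp add: card_of_nat_image_lessThan)
qed

section \<open>Dirichlet convolution of multiplicative functions\<close>

lemma multiplicative_fun_mult:
  assumes "multiplicative_fun g" "coprime m n" "m > 0" "n > 0"
  shows "g (m * n) = g m * g n"
  using assms by (simp add: multiplicative_fun_def)

lemma multiplicative_fun_eqI:
  assumes "multiplicative_fun g" "multiplicative_fun h"
    and prime_powers: "\<And>p k. prime p \<Longrightarrow> k > 0 \<Longrightarrow> g (p ^ k) = h (p ^ k)"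
    and "n > 0"
  shows "g n = h n"
  using \<open>n > 0\<close>
proof (induction n rule: less_induct)
  case (less n)
  show ?case
  proof (cases "n = 1")
    case True
    then show ?thesis using assms(1,2) by (simp add: multiplicative_fun_def)
  next
    case False
    then obtain p where "prime p" "p dvd n" using prime_factor_nat by blast
    define k where "k = multiplicity p n"
    obtain m where factorization: "n = p ^ k * m" and "\<not> p dvd m"
      using less.prems \<open>prime p\<close>
      by (metis k_def multiplicity_decompose' not_prime_unit not_gr_zero)
    have "k > 0"
      using \<open>prime p\<close> \<open>p dvd n\<close> less.prems by (simp add: k_def prime_multiplicity_gt_zero_iff)
    then have "p ^ k > 1"
      using \<open>prime p\<close> by (intro one_less_power prime_gt_1_nat)
    have "m > 0" using \<open>\<not> p dvd m\<close> by (intro Nat.gr0I) auto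
    then have "m < n" using \<open>p ^ k > 1\<close> by (simp add: factorization)
    have "p ^ k > 0" using \<open>p ^ k > 1\<close> by linarith
    moreover have "coprime (p ^ k) m"
      using \<open>prime p\<close> \<open>\<not> p dvd m\<close> by (simp add: prime_imp_coprime)
    ultimately have "g n = g (p ^ k) * g m" "h n = h (p ^ k) * h m"
      using assms(1,2) \<open>m > 0\<close> unfolding factorization by (simp_all only: multiplicative_fun_mult)
    then show ?thesis
      using less.IH \<open>m < n\<close> \<open>m > 0\<close> prime_powers \<open>prime p\<close> \<open>k > 0\<close> by simp
  qed
qed

definition dirichlet_conv :: "(nat \<Rightarrow> 'a::semiring_0) \<Rightarrow> (nat \<Rightarrow> 'a) \<Rightarrow> nat \<Rightarrow> 'a" where
  "dirichlet_conv g h n = (\<Sum>d | d dvd n. g d * h (n div d))"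

lemma dirichlet_conv_prime_power:
  assumes "prime p"
  shows "dirichlet_conv g h (p ^ k) = (\<Sum>i=0..k. g (p ^ i) * h (p ^ (k - i)))"
proof -
  have "p > 1" using assms by (rule prime_gt_1_nat)
  have "{d. d dvd p ^ k} = (\<lambda>i. p ^ i) ` {0..k}"
    using divides_primepow_nat[OF assms] by auto
  moreover have "inj_on (\<lambda>i. p ^ i) {0..k}" using \<open>p > 1\<close> by (auto intro: inj_onI)
  moreover have "p ^ k div p ^ i = p ^ (k - i)" if "i \<le> k" for i
    using \<open>p > 1\<close> that by (simp add: power_diff)
  ultimately show ?thesis
    by (simp add: dirichlet_conv_def sum.reindex)
qed

lemma bij_betw_mult_divisors:
  fixes m n :: nat
  assumes "coprime m n"
  shows "bij_betw (\<lambda>(a, b). a * b) ({a. a dvd m} \<times> {b. b dvd n}) {d. d dvd m * n}"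
proof (rule bij_betw_imageI)
  have "gcd (a * b) m = a \<and> gcd (a * b) n = b" if "a dvd m" "b dvd n" for a b
  proof -
    have "coprime m b" "coprime n a"
      using assms that coprime_divisors coprime_commute dvd_refl by metis+
    then show ?thesis using that
      by (simp add: gcd_mult_left_right_cancel gcd_mult_left_left_cancel gcd_nat.absorb1)
  qed
  then show "inj_on (\<lambda>(a, b). a * b) ({a. a dvd m} \<times> {b. b dvd n})"
    by (intro inj_onI) (clarsimp, metis)
  show "(\<lambda>(a, b). a * b) ` ({a. a dvd m} \<times> {b. b dvd n}) = {d. d dvd m * n}"
  proof (intro equalityI subsetI)
    fix d assume "d \<in> {d. d dvd m * n}"
    then obtain a b where "d = a * b" "a dvd m" "b dvd n" using division_decomp by blast
    then show "d \<in> (\<lambda>(a, b). a * b) ` ({a. a dvd m} \<times> {b. b dvd n})" by force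
  qed (auto intro: mult_dvd_mono)
qed

lemma multiplicative_dirichlet_conv:
  assumes g: "multiplicative_fun g" and h: "multiplicative_fun h"
  shows "multiplicative_fun (dirichlet_conv g h)"
  unfolding multiplicative_fun_def
proof (intro conjI allI impI)
  show "dirichlet_conv g h 1 = 1"
    using g h by (simp add: dirichlet_conv_def multiplicative_fun_def)
next
  fix m n :: nat
  assume pos: "m > 0" "n > 0" and "coprime m n"
  have summand_mult: "g (a * b) * h (m * n div (a * b)) = (g a * h (m div a)) * (g b * h (n div b))"
    if "a dvd m" "b dvd n" for a b
  proof -
    from that obtain a' b' where factors: "m = a * a'" "n = b * b'" by (auto elim!: dvdE)
    then have "a > 0" "a' > 0" "b > 0" "b' > 0" using pos by auto
    moreover have "coprime a b" "coprime a' b'"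
      using \<open>coprime m n\<close> factors by (auto simp: coprime_mult_left_iff coprime_mult_right_iff)
    moreover have "m * n div (a * b) = (m div a) * (n div b)"
      using that by (simp add: div_mult_div_if_dvd)
    ultimately show ?thesis using g h by (simp add: multiplicative_fun_mult factors)
  qed
  have "dirichlet_conv g h (m * n)
      = (\<Sum>(a, b)\<in>{a. a dvd m} \<times> {b. b dvd n}. g (a * b) * h (m * n div (a * b)))"
    unfolding dirichlet_conv_def
    by (subst sum.reindex_bij_betw[OF bij_betw_mult_divisors[OF \<open>coprime m n\<close>], symmetric])
      (simp add: case_prod_unfold)
  also have "\<dots> = (\<Sum>(a, b)\<in>{a. a dvd m} \<times> {b. b dvd n}.
      (g a * h (m div a)) * (g b * h (n div b)))"
    by (intro sum.cong refl) (auto simp: summand_mult)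
  also have "\<dots> = dirichlet_conv g h m * dirichlet_conv g h n"
    by (simp add: dirichlet_conv_def sum_product sum.cartesian_product)
  finally show "dirichlet_conv g h (m * n) = dirichlet_conv g h m * dirichlet_conv g h n" .
qed

section \<open>Additivity of the fold exponent\<close>

lemma fps_power_nth_compositions:
  fixes F :: "'a::idom fps"
  assumes "fps_nth F 0 = 0"
  shows "fps_nth (F ^ r) n = (\<Sum>ls\<in>compositions r n. \<Prod>l\<leftarrow>ls. fps_nth F l)"
proof (cases r)
  case 0
  moreover have "compositions 0 n = (if n = 0 then {[]} else {})"
    by (auto simp: compositions_def)
  ultimately show ?thesis by simp
next
  case (Suc m)
  have "fps_nth (F ^ r) n = (\<Sum>ls\<in>natpermute n r. \<Prod>j\<in>{0..m}. fps_nth F (ls ! j))"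
    using Suc by (simp add: fps_power_nth del: power_Suc)
  also have "\<dots> = (\<Sum>ls\<in>natpermute n r. \<Prod>l\<leftarrow>ls. fps_nth F l)"
    using Suc by (intro sum.cong refl)
      (simp add: natpermute_def prod.list_conv_set_nth atLeastLessThanSuc_atLeastAtMost)
  also have "\<dots> = (\<Sum>ls\<in>compositions r n. \<Prod>l\<leftarrow>ls. fps_nth F l)"
  proof (intro sum.mono_neutral_right ballI)
    fix ls assume "ls \<in> natpermute n r - compositions r n"
    then have "0 \<in> set ls" by (auto simp: natpermute_def compositions_def not_less_eq_eq)
    then show "(\<Prod>l\<leftarrow>ls. fps_nth F l) = 0"
      using assms by (force simp: prod_list_zero_iff)
  qed (rule natpermute_finite, auto simp: natpermute_def compositions_def)
  finally show ?thesis .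
qed

definition local_series :: "(nat \<Rightarrow> complex) \<Rightarrow> nat \<Rightarrow> complex fps" where
  "local_series f p = Abs_fps (\<lambda>k. if k = 0 then 0 else f (p ^ k))"

definition zfold_series :: "(nat \<Rightarrow> complex) \<Rightarrow> complex \<Rightarrow> nat \<Rightarrow> complex fps" where
  "zfold_series f z p = fps_binomial z oo local_series f p"

lemma zfold_series_add:
  "zfold_series f (u + v) p = zfold_series f u p * zfold_series f v p"
  unfolding zfold_series_def fps_binomial_add_mult
  by (rule fps_compose_mult_distrib) (simp add: local_series_def)

lemma local_series_power_nth:
  "fps_nth (local_series f p ^ r) k = (\<Sum>ls\<in>compositions r k. \<Prod>l\<leftarrow>ls. f (p ^ l))"
proof -
  have "(\<Prod>l\<leftarrow>ls. fps_nth (local_series f p) l) = (\<Prod>l\<leftarrow>ls. f (p ^ l))"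
    if "ls \<in> compositions r k" for ls
    using that
    by (intro arg_cong[where f = prod_list] map_cong) (auto simp: compositions_def local_series_def)
  then show ?thesis
    by (simp add: fps_power_nth_compositions local_series_def)
qed

lemma zfold_series_nth:
  assumes "k \<ge> 1"
  shows "fps_nth (zfold_series f z p) k = zfold_local f z p k"
proof -
  have "fps_nth (zfold_series f z p) k
      = (\<Sum>r=0..k. (z gchoose r) * fps_nth (local_series f p ^ r) k)"
    by (simp add: zfold_series_def fps_compose_nth)
  also have "\<dots> = (\<Sum>r=1..k. (z gchoose r) * fps_nth (local_series f p ^ r) k)"
    using assms by (intro sum.mono_neutral_right) (auto simp: not_less_eq_eq)
  finally show ?thesis by (simp add: zfold_local_def local_series_power_nth)
qed

lemma zfold_conv_prime_power_series:
  assumes "prime p"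
  shows "zfold_conv f z (p ^ k) = fps_nth (zfold_series f z p) k"
proof (cases "k = 0")
  case True
  then show ?thesis using zfold_conv_1 by (simp add: zfold_series_def)
next
  case False
  then show ?thesis using assms by (simp add: zfold_conv_prime_power zfold_series_nth)
qed

lemma dirichlet_conv_zfold_conv:
  assumes "n > 0"
  shows "dirichlet_conv (zfold_conv f u) (zfold_conv f v) n = zfold_conv f (u + v) n"
proof (rule multiplicative_fun_eqI[OF _ _ _ assms])
  show "dirichlet_conv (zfold_conv f u) (zfold_conv f v) (p ^ k) = zfold_conv f (u + v) (p ^ k)"
    if "prime p" for p k
    using that
    by (simp add: dirichlet_conv_prime_power zfold_conv_prime_power_series zfold_series_add fps_mult_nth)
qed (intro multiplicative_dirichlet_conv multiplicative_zfold_conv)+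

section \<open>Polynomial dependence on the fold exponent\<close>

definition gbinomial_poly :: "nat \<Rightarrow> 'a::field_char_0 poly" where
  "gbinomial_poly r = smult (1 / fact r) (\<Prod>i=0..<r. [:- of_nat i, 1:])"

lemma poly_gbinomial_poly: "poly (gbinomial_poly r) z = z gchoose r"
  by (simp add: gbinomial_poly_def poly_prod gbinomial_prod_rev)

lemma degree_gbinomial_poly: "degree (gbinomial_poly r :: 'a::field_char_0 poly) = r"
  by (simp add: gbinomial_poly_def degree_prod_eq_sum_degree)

definition zfold_local_poly :: "(nat \<Rightarrow> complex) \<Rightarrow> nat \<Rightarrow> nat \<Rightarrow> complex poly" where
  "zfold_local_poly f p k =
     (\<Sum>r=1..k. smult (\<Sum>ls\<in>compositions r k. \<Prod>l\<leftarrow>ls. f (p ^ l)) (gbinomial_poly r))"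

lemma poly_zfold_local_poly: "poly (zfold_local_poly f p k) z = zfold_local f z p k"
  by (simp add: zfold_local_poly_def zfold_local_def poly_sum poly_gbinomial_poly mult.commute)

lemma degree_zfold_local_poly_le: "degree (zfold_local_poly f p k) \<le> k"
  unfolding zfold_local_poly_def
  by (intro degree_sum_le)
    (auto intro: order.trans[OF degree_smult_le] simp: degree_gbinomial_poly)

definition zfold_poly :: "(nat \<Rightarrow> complex) \<Rightarrow> nat \<Rightarrow> complex poly" where
  "zfold_poly f n = (\<Prod>p\<in>prime_factors n. zfold_local_poly f p (multiplicity p n))"

lemma poly_zfold_poly: "poly (zfold_poly f n) z = zfold_conv f z n"
  by (simp add: zfold_poly_def zfold_conv_def poly_prod poly_zfold_local_poly)

lemma degree_zfold_poly_le: "degree (zfold_poly f n) \<le> size (prime_factorization n)"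
proof -
  have "degree (zfold_poly f n) \<le> (\<Sum>p\<in>prime_factors n. multiplicity p n)"
    unfolding zfold_poly_def
    by (intro order.trans[OF degree_prod_sum_le] sum_mono) (auto simp: degree_zfold_local_poly_le)
  also have "\<dots> = size (prime_factorization n)"
    unfolding size_multiset_overloaded_eq
    by (intro sum.cong refl) (simp add: count_prime_factorization_prime in_prime_factors_imp_prime)
  finally show ?thesis .
qed

section \<open>Smooth and rough numbers\<close>

definition smooth :: "real \<Rightarrow> nat \<Rightarrow> bool" where
  "smooth y n \<longleftrightarrow> (\<forall>p\<in>prime_factors n. real p \<le> y)"

definition rough :: "real \<Rightarrow> nat \<Rightarrow> bool" where
  "rough y n \<longleftrightarrow> (\<forall>p\<in>prime_factors n. y < real p)"

lemma smooth_iff_largest_prime_factor_le: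
  assumes "y \<ge> 1"
  shows "smooth y n \<longleftrightarrow> real (largest_prime_factor n) \<le> y"
proof (cases "n > 1")
  case True
  then have "prime_factors n \<noteq> {}" by (simp add: prime_factorization_empty_iff)
  then have "Max (prime_factors n) \<in> prime_factors n" by (intro Max_in) auto
  moreover have "p \<le> Max (prime_factors n)" if "p \<in> prime_factors n" for p
    using that by (intro Max_ge) auto
  ultimately show ?thesis using True
    by (metis largest_prime_factor_def of_nat_mono order.trans smooth_def)
next
  case False
  then have "n = 0 \<or> n = 1" by auto
  then show ?thesis using assms by (auto simp: largest_prime_factor_def smooth_def)
qed

lemma smooth_rough_decomposition:
  assumes "n > 0"
  obtains a b where "n = a * b" "smooth y a" "rough y b"
proof
  define P where "P = prime_factorization n"
  define small where "small = filter_mset (\<lambda>p. real p \<le> y) P"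
  define large where "large = filter_mset (\<lambda>p. \<not> real p \<le> y) P"
  have "prod_mset small * prod_mset large = prod_mset P"
    unfolding small_def large_def by (metis multiset_partition prod_mset_Un)
  then show "n = prod_mset small * prod_mset large" using assms by (simp add: P_def)
  have "prime_factorization (prod_mset small) = small"
      "prime_factorization (prod_mset large) = large"
    by (intro prime_factorization_prod_mset_primes;
        auto simp: small_def large_def P_def in_prime_factors_imp_prime)+
  then show "smooth y (prod_mset small)" "rough y (prod_mset large)"
    by (auto simp: smooth_def rough_def small_def large_def)
qed

lemma coprime_smooth_rough:
  assumes "smooth y a" "rough y b" "a > 0" "b > 0"
  shows "coprime a b"
proof (rule ccontr)
  assume "\<not> coprime a b"
  then obtain p where "prime p" "p dvd gcd a b"
    using prime_factor_nat[of "gcd a b"] by (auto simp: coprime_iff_gcd_eq_1)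
  then have "p \<in> prime_factors a" "p \<in> prime_factors b"
    using assms(3,4) by (auto simp: prime_factors_dvd)
  then show False using assms(1,2) by (force simp: smooth_def rough_def)
qed

lemma smooth_divisors_mult_rough:
  assumes "smooth y a" "rough y b" "a > 0" "b > 0"
  shows "{d. d dvd a * b \<and> smooth y d} = {d. d dvd a}"
proof (intro equalityI subsetI CollectI conjI; elim CollectE conjE)
  fix d assume "d dvd a * b" "smooth y d"
  moreover from this have "coprime d b"
    using assms by (intro coprime_smooth_rough[of y]) (auto intro!: Nat.gr0I)
  ultimately show "d dvd a" by (simp add: coprime_dvd_mult_left_iff)
next
  fix d assume "d dvd a"
  then show "d dvd a * b" by simp
  show "smooth y d"
    using assms(1,3) dvd_prime_factors[OF _ \<open>d dvd a\<close>] by (auto simp: smooth_def)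
qed

lemma power_size_less_prod_mset:
  fixes y :: "'a::linordered_idom"
  assumes "M \<noteq> {#}" "y \<ge> 0" "\<And>p. p \<in># M \<Longrightarrow> y < f p"
  shows "y ^ size M < (\<Prod>p\<in>#M. f p)"
  using assms(1,3)
proof (induction M)
  case empty
  then show ?case by simp
next
  case (add p M)
  show ?case
  proof (cases "M = {#}")
    case True
    then show ?thesis using add.prems by simp
  next
    case False
    then have "y ^ size M < (\<Prod>p\<in>#M. f p)" "y < f p" using add by auto
    then show ?thesis using assms(2) by (simp add: mult_strict_mono')
  qed
qed

lemma of_nat_prod_mset:
  "of_nat (prod_mset M) = (\<Prod>p\<in>#M. of_nat p :: 'a::comm_semiring_1)"
  by (induction M) simp_all

lemma size_prime_factorization_rough_less:
  assumes "rough y n" "n > 0" "y \<ge> 1" "real n \<le> y ^ K" "K > 0"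
  shows "size (prime_factorization n) < K"
proof (cases "prime_factorization n = {#}")
  case True
  then show ?thesis using assms(5) by simp
next
  case False
  have "y ^ size (prime_factorization n) < (\<Prod>p\<in>#prime_factorization n. real p)"
    using False assms(1,3) by (intro power_size_less_prod_mset) (auto simp: rough_def)
  also have "\<dots> = real n" using assms(2) by (simp flip: of_nat_prod_mset)
  also note \<open>real n \<le> y ^ K\<close>
  finally show ?thesis using assms(3) by (meson not_less power_increasing)
qed

section \<open>The interpolation formula\<close>

lemma sum_smooth_factorizations:
  assumes "y \<ge> 1" "n > 0"
  shows "(\<Sum>(n1, n2)\<in>{(n1, n2). n = n1 * n2 \<and> real (largest_prime_factor n1) \<le> y}. g n1 * h n2)
    = (\<Sum>d | d dvd n \<and> smooth y d. g d * h (n div d))"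
  using assms
  by (intro sum.reindex_bij_witness[where i = "\<lambda>d. (d, n div d)" and j = fst])
    (auto simp: smooth_iff_largest_prime_factor_le)

lemma sum_smooth_divisors_mult_rough:
  assumes "multiplicative_fun h" "smooth y a" "rough y b" "a > 0" "b > 0"
  shows "(\<Sum>d | d dvd a * b \<and> smooth y d. g d * h (a * b div d)) = dirichlet_conv g h a * h b"
proof -
  have "h (a * b div d) = h (a div d) * h b" if "d dvd a" for d
  proof -
    have "coprime a b" using assms(2-) by (rule coprime_smooth_rough)
    then have "coprime (a div d) b"
      using that by (metis coprime_mult_left_iff dvd_div_mult_self)
    moreover have "a div d > 0" using that \<open>a > 0\<close> by (auto elim!: dvdE)
    moreover have "a * b div d = a div d * b" using that by (simp add: dvd_div_mult)
    ultimately show ?thesis using assms(1,5) by (simp add: multiplicative_fun_mult)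
  qed
  then show ?thesis
    unfolding smooth_divisors_mult_rough[OF assms(2-)] dirichlet_conv_def
    by (simp add: sum_distrib_right mult.assoc)
qed

lemma sum_smooth_zfold_conv:
  assumes "y \<ge> 1" "smooth y a" "rough y b" "a > 0" "b > 0"
  shows "(\<Sum>(n1, n2)\<in>{(n1, n2). a * b = n1 * n2 \<and> real (largest_prime_factor n1) \<le> y}.
      zfold_conv f u n1 * zfold_conv f v n2) = zfold_conv f (u + v) a * zfold_conv f v b"
  using assms multiplicative_zfold_conv
  by (simp add: sum_smooth_factorizations sum_smooth_divisors_mult_rough dirichlet_conv_zfold_conv)

lemma zfold_conv_eq_smooth_interpolation:
  assumes "K > 0" "x \<ge> 1" "n > 0" "real n \<le> x"
  shows "zfold_conv f z n =
    (\<Sum>l<K. lagrange_coeff K z l *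
      (\<Sum>(n1, n2) \<in> {(n1, n2). n = n1 * n2 \<and>
          real (largest_prime_factor n1) \<le> x powr (1 / real K)}.
        zfold_conv f (z - of_nat l) n1 * zfold_conv f (of_nat l) n2))"
proof -
  define y where "y = x powr (1 / real K)"
  have "y \<ge> 1" "y ^ K = x"
    using assms(1,2) by (simp_all add: y_def ge_one_powr_ge_zero powr_powr flip: powr_realpow)
  obtain a b where factorization: "n = a * b" and "smooth y a" "rough y b"
    using smooth_rough_decomposition[OF assms(3)] .
  have "a > 0" "b > 0" using factorization assms(3) by auto
  then have "real b \<le> y ^ K"
    using factorization assms(4) \<open>y ^ K = x\<close> by (auto intro: order.trans[rotated])
  then have "size (prime_factorization b) < K"
    using \<open>rough y b\<close> \<open>b > 0\<close> \<open>y \<ge> 1\<close> \<open>K > 0\<close> by (intro size_prime_factorization_rough_less)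
  with degree_zfold_poly_le have "degree (zfold_poly f b) < K" by (rule le_less_trans)
  from lagrange_interpolation_of_nat[OF this, of z]
  have interpolation: "zfold_conv f z b = (\<Sum>l<K. lagrange_coeff K z l * zfold_conv f (of_nat l) b)"
    by (simp add: poly_zfold_poly)
  have "coprime a b"
    using \<open>smooth y a\<close> \<open>rough y b\<close> \<open>a > 0\<close> \<open>b > 0\<close> by (rule coprime_smooth_rough)
  then have "zfold_conv f z n = zfold_conv f z a * zfold_conv f z b"
    using multiplicative_zfold_conv \<open>a > 0\<close> \<open>b > 0\<close> by (simp add: factorization multiplicative_fun_mult)
  also have "\<dots> = (\<Sum>l<K. lagrange_coeff K z l * (zfold_conv f z a * zfold_conv f (of_nat l) b))"
    by (subst interpolation) (simp add: sum_distrib_left mult.left_commute)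
  also have "\<dots> = (\<Sum>l<K. lagrange_coeff K z l *
      (\<Sum>(n1, n2)\<in>{(n1, n2). n = n1 * n2 \<and> real (largest_prime_factor n1) \<le> y}.
        zfold_conv f (z - of_nat l) n1 * zfold_conv f (of_nat l) n2))"
    using \<open>y \<ge> 1\<close> \<open>smooth y a\<close> \<open>rough y b\<close> \<open>a > 0\<close> \<open>b > 0\<close>
    by (simp add: factorization sum_smooth_zfold_conv)
  finally show ?thesis by (simp add: y_def)
qed

theorem theorem3p3:
  fixes K :: nat and A :: real
  assumes "K > 0" and "A \<ge> 1"
  shows "\<exists>C::real. \<forall>z::complex. \<exists>c::nat \<Rightarrow> complex.
    (\<forall>(x::real) (f::nat \<Rightarrow> complex) (n::nat).
       x \<ge> 1 \<longrightarrow> multiplicative_fun f \<longrightarrow> n > 0 \<longrightarrow> real n \<le> x \<longrightarrow>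
       zfold_conv f z n =
         (\<Sum>l<K. c l *
           (\<Sum>(n1, n2) \<in> {(n1, n2). n = n1 * n2 \<and>
                real (largest_prime_factor n1) \<le> x powr (1 / real K)}.
              zfold_conv f (z - of_nat l) n1 * zfold_conv f (of_nat l) n2))) \<and>
    (cmod z \<le> A \<longrightarrow> (\<forall>l<K. cmod (c l) \<le> C))"
proof (rule exI, rule allI, rule exI, intro conjI allI impI)
  fix z :: complex and x :: real and f :: "nat \<Rightarrow> complex" and n :: nat
  assume "x \<ge> 1" "n > 0" "real n \<le> x"
  with \<open>K > 0\<close> show "zfold_conv f z n =
      (\<Sum>l<K. lagrange_coeff K z l *
        (\<Sum>(n1, n2) \<in> {(n1, n2). n = n1 * n2 \<and>
            real (largest_prime_factor n1) \<le> x powr (1 / real K)}.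
          zfold_conv f (z - of_nat l) n1 * zfold_conv f (of_nat l) n2))"
    by (rule zfold_conv_eq_smooth_interpolation)
next
  fix z :: complex and l :: nat
  assume "cmod z \<le> A" "l < K"
  then show "cmod (lagrange_coeff K z l) \<le> (A + real K) ^ (K - 1)"
    by (rule norm_lagrange_coeff_le)
qed

end
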